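(* Let $2\le k\le6$, $\tau>0$, and let $\mathbf{X}^0,\mathbf{X}^1,\dots,\mathbf{X}^{k-1}\in[V^h]^2$ be starting values, where $\mathbf{X}^1,\dots,\mathbf{X}^{k-1}$ are generated from $\mathbf{X}^0$ by lower-order AP-BDF schemes (see context). For each $m\ge k-1$ let $(\mathbf{X}^{m+1},\kappa^{m+1},\eta^{m+1})\in[V^h]^2\times V^h\times\mathbb{R}$ be a solution of the AP-BDF$k$ scheme: for all $(\varphi^h,\boldsymbol{\omega}^h)\in V^h\times[V^h]^2$, writing $\widetilde\Gamma=\widetilde\Gamma^{m+1}$ and $\widetilde{\mathbf{n}}=\widetilde{\mathbf{n}}^{m+1}$, \begin{align*} \Big(\frac1\tau\sum_{i=0}^k\delta_i\mathbf{X}^{m+1-i},\varphi^h\widetilde{\mathbf{n}}\Big)^h_{\widetilde\Gamma}+\left(\partial_s\kappa^{m+1},\partial_s\varphi^h\right)_{\widetilde\Gamma}-\eta^{m+1}\left(1,\varphi^h\right)^h_{\widetilde\Gamma}&=0,\\ \left(\kappa^{m+1}\widetilde{\mathbf{n}},\boldsymbol{\omega}^h\right)^h_{\widetilde\Gamma}-\left(\partial_s\mathbf{X}^{m+1},\partial_s\boldsymbol{\omega}^h\right)_{\widetilde\Gamma}&=0,\\ \sum_{i=0}^k\delta_iA^{m+1-i}&=0, \end{align*} where $A^m=A(\mathbf{X}^m)$, the coefficients $\delta_0,\dots,\delta_k$ are defined by $\sum_{i=0}^k\delta_i\zeta^i=\sum_{\ell=1}^k\frac1\ell(1-\zeta)^\ell$,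 and $\widetilde\Gamma^{m+1}$ is a predicted polygon with normal $\widetilde{\mathbf{n}}^{m+1}$ (see context). Then the scheme is area-preserving: for all $m\ge0$, $$A^{m+1}=A^m=\dots=A^0 .$$
   Context: Let $\mathbb{I}=[0,1]=\bigcup_{j=1}^N I_j$, $N\ge3$, $I_j=[\rho_{j-1},\rho_j]$, $0=\rho_0<\dots<\rho_N=1$, and $$V^h=\{u\in C(\mathbb{I}):u|_{I_j}\text{ is linear for all }j=1,\dots,N,\ u(\rho_0)=u(\rho_N)\}.$$ For $\mathbf{X}\in[V^h]^2$ with polygon $\Gamma=\mathbf{X}(\mathbb{I})$ set $\mathbf{h}_j=\mathbf{X}(\rho_j)-\mathbf{X}(\rho_{j-1})$ (assumed nonzero for all $j$). On $\Gamma$ the piecewise constant normal and the tangential derivative are $\mathbf{n}|_{I_j}=-\mathbf{h}_j^\perp/|\mathbf{h}_j|$ and $\partial_sf|_{I_j}=\partial_\rho f/|\partial_\rho\mathbf{X}|$, where $(\cdot)^\perp$ is clockwise rotation by $\pi/2$, $(a,b)^\perp=(b,-a)$. The inner products are $(u,v)_\Gamma=\int_{\mathbb{I}}u\cdot v\,|\partial_\rho\mathbf{X}|\,\mathrm{d}\rho$ and the mass-lumped one $$(u,v)^h_\Gamma=\frac12\sum_{j=1}^N|\mathbf{h}_j|\left[(u\cdot v)(\rho_j^-)+(u\cdot v)(\rho_{j-1}^+)\right]$$ for piecewise continuous scalar/vector functions with one-sided limits $u(\rho_j^\pm)$. Within an inner product on a polygon, $\partial_s$ is the tangential derivative of that polygon.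 The area is $A(\mathbf{X})=\frac12\int_{\Gamma}\mathbf{X}\cdot\mathbf{n}\,\mathrm{d}s=-\frac12\int_{\mathbb{I}}\mathbf{X}\cdot(\partial_\rho\mathbf{X})^\perp\,\mathrm{d}\rho$. AP-BDF1 (AP-Euler) scheme with time step $\sigma>0$: given $\mathbf{X}\in[V^h]^2$ (polygon $\Gamma$, normal $\mathbf{n}$), a step produces $\mathbf{Y}\in[V^h]^2$ if there are $\kappa\in V^h$ and $e\in\mathbb{R}$ such that for all $\varphi^h\in V^h$, $\boldsymbol{\omega}^h\in[V^h]^2$: $$\left(\tfrac{\mathbf{Y}-\mathbf{X}}{\sigma},\varphi^h\mathbf{n}\right)^h_\Gamma+(\partial_s\kappa,\partial_s\varphi^h)_\Gamma-e\,(1,\varphi^h)^h_\Gamma=0,\quad(\kappa\,\mathbf{n},\boldsymbol{\omega}^h)^h_\Gamma-(\partial_s\mathbf{Y},\partial_s\boldsymbol{\omega}^h)_\Gamma=0,\quad A(\mathbf{Y})-A(\mathbf{X})=0.$$ The family of AP-BDF$k$ schemes is defined recursively in the order $k$. Starting values: each of $\mathbf{X}^1,\dots,\mathbf{X}^{k-1}$ (approximations at times $\tau,\dots,(k-1)\tau$) is an iterate of an AP-BDF$r$ scheme of lower order $1\le r<k$, started from $\mathbf{X}^0$ and run with a smaller time step, whose own starting values are generated in the same way. (In practice the step is chosen so that the errors of the starting curves are $O(\tau^k)$.) Prediction: the polygon $\widetilde\Gamma^{m+1}=\widetilde{\mathbf{X}}^{m+1}(\mathbb{I})$, $\widetilde{\mathbf{X}}^{m+1}\in[V^h]^2$,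 is obtained by one step of the AP-BDF$(k-1)$ scheme with time step $\tau$ from the previously computed $\mathbf{X}^m,\mathbf{X}^{m-1},\dots,\mathbf{X}^{m-k+2}$. *)

theory Defs
  imports "HOL-Analysis.Analysis" "HOL-Computational_Algebra.Polynomial"
begin

definition mesh :: "nat \<Rightarrow> (nat \<Rightarrow> real) \<Rightarrow> bool" where
  "mesh N \<rho> \<longleftrightarrow> 3 \<le> N \<and> \<rho> 0 = 0 \<and> \<rho> N = 1 \<and> (\<forall>j\<in>{1..N}. \<rho> (j - 1) < \<rho> j)"

text \<open>Elements of \<open>C([0,1])\<close> are represented by total functions; every notion below depends
  only on their restriction to \<open>[0,1]\<close>.\<close>

definition Vh :: "nat \<Rightarrow> (nat \<Rightarrow> real) \<Rightarrow> (real \<Rightarrow> real) set" where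
  "Vh N \<rho> = {u. continuous_on {0..1} u
      \<and> (\<forall>j\<in>{1..N}. \<exists>a b. \<forall>s\<in>{\<rho> (j - 1)..\<rho> j}. u s = a * s + b)
      \<and> u (\<rho> 0) = u (\<rho> N)}"

definition Vh2 :: "nat \<Rightarrow> (nat \<Rightarrow> real) \<Rightarrow> (real \<Rightarrow> real ^ 2) set" where
  "Vh2 N \<rho> = {X. \<forall>i. (\<lambda>s. X s $ i) \<in> Vh N \<rho>}"

definition edge :: "(nat \<Rightarrow> real) \<Rightarrow> (real \<Rightarrow> real ^ 2) \<Rightarrow> nat \<Rightarrow> real ^ 2" where
  "edge \<rho> X j = X (\<rho> j) - X (\<rho> (j - 1))"

text \<open>The curves whose polygon may carry normals, tangential derivatives and inner products.\<close>

definition polygons :: "nat \<Rightarrow> (nat \<Rightarrow> real) \<Rightarrow> (real \<Rightarrow> real ^ 2) set" where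
  "polygons N \<rho> = {X \<in> Vh2 N \<rho>. \<forall>j\<in>{1..N}. edge \<rho> X j \<noteq> 0}"

definition perp :: "real ^ 2 \<Rightarrow> real ^ 2" where
  "perp v = vector [v $ 2, - (v $ 1)]"

text \<open>The derivative is unspecified at the finitely many nodes, where it need not exist. It is only
  used under integrals.\<close>

definition d_rho :: "(real \<Rightarrow> 'a::real_normed_vector) \<Rightarrow> real \<Rightarrow> 'a" where
  "d_rho f s = vector_derivative f (at s within {0..1})"

definition d_s :: "(real \<Rightarrow> real ^ 2) \<Rightarrow> (real \<Rightarrow> 'a::real_normed_vector) \<Rightarrow> real \<Rightarrow> 'a" where
  "d_s X f s = d_rho f s /\<^sub>R norm (d_rho X s)"

text \<open>\<open>cell \<rho> s\<close> is the index \<open>j\<close> with \<open>s \<in> I\<^sub>j\<close>. At an interior node this selects the interval on its left;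
  the choice is immaterial, because the normal only enters through one-sided limits and integrals.\<close>

definition cell :: "(nat \<Rightarrow> real) \<Rightarrow> real \<Rightarrow> nat" where
  "cell \<rho> s = (LEAST j. 1 \<le> j \<and> s \<le> \<rho> j)"

definition normal :: "(nat \<Rightarrow> real) \<Rightarrow> (real \<Rightarrow> real ^ 2) \<Rightarrow> real \<Rightarrow> real ^ 2" where
  "normal \<rho> X s = - (perp (edge \<rho> X (cell \<rho> s)) /\<^sub>R norm (edge \<rho> X (cell \<rho> s)))"

definition ip :: "(real \<Rightarrow> real ^ 2) \<Rightarrow> (real \<Rightarrow> 'a::real_inner) \<Rightarrow> (real \<Rightarrow> 'a) \<Rightarrow> real" where
  "ip X u v = integral {0..1} (\<lambda>s. (u s \<bullet> v s) * norm (d_rho X s))"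

definition ip_lumped :: "nat \<Rightarrow> (nat \<Rightarrow> real) \<Rightarrow> (real \<Rightarrow> real ^ 2)
    \<Rightarrow> (real \<Rightarrow> 'a::real_inner) \<Rightarrow> (real \<Rightarrow> 'a) \<Rightarrow> real" where
  "ip_lumped N \<rho> X u v = 1 / 2 * (\<Sum>j=1..N. norm (edge \<rho> X j) *
      (Lim (at_left (\<rho> j)) (\<lambda>s. u s \<bullet> v s) + Lim (at_right (\<rho> (j - 1))) (\<lambda>s. u s \<bullet> v s)))"

text \<open>On \<open>polygons N \<rho>\<close> this equals \<open>1 / 2 * ip X X (normal \<rho> X)\<close>, i.e. half the integral of \<open>X \<bullet> n\<close> over
  the polygon; written this way it makes sense on all of \<open>Vh2 N \<rho>\<close>.\<close>

definition area :: "(real \<Rightarrow> real ^ 2) \<Rightarrow> real" where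
  "area X = - (1 / 2) * integral {0..1} (\<lambda>s. X s \<bullet> perp (d_rho X s))"

text \<open>The coefficient of \<open>\<zeta>\<^sup>i\<close> in the sum over \<open>l = 1, ..., k\<close> of \<open>(1 - \<zeta>)\<^sup>l / l\<close>.\<close>

definition bdf_coeff :: "nat \<Rightarrow> nat \<Rightarrow> real" where
  "bdf_coeff k i = coeff (\<Sum>l=1..k. smult (1 / real l) ([:1, -1:] ^ l)) i"

definition ap_euler_step :: "nat \<Rightarrow> (nat \<Rightarrow> real) \<Rightarrow> real
    \<Rightarrow> (real \<Rightarrow> real ^ 2) \<Rightarrow> (real \<Rightarrow> real ^ 2) \<Rightarrow> bool" where
  "ap_euler_step N \<rho> \<sigma> X Y \<longleftrightarrow> X \<in> polygons N \<rho> \<and> Y \<in> Vh2 N \<rho> \<and>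
    (\<exists>\<kappa>\<in>Vh N \<rho>. \<exists>e.
      (\<forall>\<phi>\<in>Vh N \<rho>.
        ip_lumped N \<rho> X (\<lambda>s. (Y s - X s) /\<^sub>R \<sigma>) (\<lambda>s. \<phi> s *\<^sub>R normal \<rho> X s)
        + ip X (d_s X \<kappa>) (d_s X \<phi>) - e * ip_lumped N \<rho> X (\<lambda>s. 1) \<phi> = 0) \<and>
      (\<forall>\<omega>\<in>Vh2 N \<rho>.
        ip_lumped N \<rho> X (\<lambda>s. \<kappa> s *\<^sub>R normal \<rho> X s) \<omega> - ip X (d_s X Y) (d_s X \<omega>) = 0) \<and>
      area Y - area X = 0)"

text \<open>The system of the scheme of order \<open>k\<close> on the polygon of \<open>P\<close>. The curves are numbered backwards
  in time: \<open>Z i\<close> stands for \<open>X\<^sup>m\<^sup>+\<^sup>1\<^sup>-\<^sup>i\<close>, so \<open>Z 0\<close> is the new one.\<close>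

definition ap_bdf_system :: "nat \<Rightarrow> (nat \<Rightarrow> real) \<Rightarrow> nat \<Rightarrow> real \<Rightarrow> (real \<Rightarrow> real ^ 2)
    \<Rightarrow> (nat \<Rightarrow> real \<Rightarrow> real ^ 2) \<Rightarrow> (real \<Rightarrow> real) \<Rightarrow> real \<Rightarrow> bool" where
  "ap_bdf_system N \<rho> k \<tau> P Z \<kappa> \<eta> \<longleftrightarrow>
      (\<forall>\<phi>\<in>Vh N \<rho>.
        ip_lumped N \<rho> P (\<lambda>s. (\<Sum>i=0..k. bdf_coeff k i *\<^sub>R Z i s) /\<^sub>R \<tau>)
            (\<lambda>s. \<phi> s *\<^sub>R normal \<rho> P s)
        + ip P (d_s P \<kappa>) (d_s P \<phi>) - \<eta> * ip_lumped N \<rho> P (\<lambda>s. 1) \<phi> = 0) \<and>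
      (\<forall>\<omega>\<in>Vh2 N \<rho>.
        ip_lumped N \<rho> P (\<lambda>s. \<kappa> s *\<^sub>R normal \<rho> P s) \<omega> - ip P (d_s P (Z 0)) (d_s P \<omega>) = 0) \<and>
      (\<Sum>i=0..k. bdf_coeff k i * area (Z i)) = 0"

text \<open>\<open>ap_bdf_step N \<rho> k \<tau> H Y\<close>: one step of the scheme of order \<open>k\<close> from \<open>H 0 = X\<^sup>m\<close>, \<open>H 1 = X\<^sup>m\<^sup>-\<^sup>1\<close>, ...,
  \<open>H (k - 1) = X\<^sup>m\<^sup>-\<^sup>k\<^sup>+\<^sup>1\<close> may produce \<open>Y\<close>. The polygon is itself predicted by a step of
  order \<open>k - 1\<close> from the same curves, down to order 1, which works on the polygon of \<open>H 0\<close>.\<close>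

fun ap_bdf_step :: "nat \<Rightarrow> (nat \<Rightarrow> real) \<Rightarrow> nat \<Rightarrow> real \<Rightarrow> (nat \<Rightarrow> real \<Rightarrow> real ^ 2)
    \<Rightarrow> (real \<Rightarrow> real ^ 2) \<Rightarrow> bool" where
  "ap_bdf_step N \<rho> 0 \<tau> H Y \<longleftrightarrow> False"
| "ap_bdf_step N \<rho> (Suc 0) \<tau> H Y \<longleftrightarrow> ap_euler_step N \<rho> \<tau> (H 0) Y"
| "ap_bdf_step N \<rho> (Suc (Suc k)) \<tau> H Y \<longleftrightarrow> Y \<in> Vh2 N \<rho> \<and>
    (\<exists>P\<in>polygons N \<rho>. ap_bdf_step N \<rho> (Suc k) \<tau> H P \<and>
      (\<exists>\<kappa>\<in>Vh N \<rho>. \<exists>\<eta>. ap_bdf_system N \<rho> (Suc (Suc k)) \<tau> P (case_nat Y H) \<kappa> \<eta>))"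

text \<open>\<open>ap_bdf_run N \<rho> k \<tau> M X\<close>: the curves \<open>X 0\<close>, ..., \<open>X M\<close> are the first iterates of a run of the scheme of
  order \<open>k\<close> with time step \<open>\<tau>\<close>. \<open>starting_value N \<rho> k \<tau> X0 j Z\<close>: the curve \<open>Z\<close> is admissible as the \<open>j\<close>-th
  starting value of such a run, at time \<open>j * \<tau>\<close>; it is an iterate, at that time, of a run of lower order
  with smaller time step. For \<open>k = 1\<close> the condition on starting values is void.\<close>

inductive
  ap_bdf_run :: "nat \<Rightarrow> (nat \<Rightarrow> real) \<Rightarrow> nat \<Rightarrow> real \<Rightarrow> nat \<Rightarrow> (nat \<Rightarrow> real \<Rightarrow> real ^ 2) \<Rightarrow> bool" and
  starting_value :: "nat \<Rightarrow> (nat \<Rightarrow> real) \<Rightarrow> nat \<Rightarrow> real \<Rightarrow> (real \<Rightarrow> real ^ 2) \<Rightarrow> nat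
    \<Rightarrow> (real \<Rightarrow> real ^ 2) \<Rightarrow> bool"
  for N :: nat and \<rho> :: "nat \<Rightarrow> real" where
  run: "\<lbrakk>1 \<le> k; 0 < \<tau>; X 0 \<in> Vh2 N \<rho>;
      \<forall>j. 1 \<le> j \<and> j \<le> k - 1 \<and> j \<le> M \<longrightarrow> starting_value N \<rho> k \<tau> (X 0) j (X j);
      \<forall>m. k - 1 \<le> m \<and> m < M \<longrightarrow> ap_bdf_step N \<rho> k \<tau> (\<lambda>i. X (m - i)) (X (m + 1))\<rbrakk>
    \<Longrightarrow> ap_bdf_run N \<rho> k \<tau> M X"
| start: "\<lbrakk>1 \<le> r; r < k; 0 < \<sigma>; \<sigma> < \<tau>; real n * \<sigma> = real j * \<tau>; ap_bdf_run N \<rho> r \<sigma> n Y\<rbrakk>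
    \<Longrightarrow> starting_value N \<rho> k \<tau> (Y 0) j (Y n)"

end

theory Submission
  imports Defs
begin

text \<open>A BDF difference operator annihilates constants, and its leading coefficient
  \<open>\<delta>\<^sub>0 = 1 + 1/2 + \<dots> + 1/k\<close> is positive. So the third equation of the scheme forces the new area to
  agree with the previous \<open>k\<close> areas whenever these coincide, and induction over the nested
  hierarchy of runs settles the starting values.\<close>

text \<open>The sum is the value at 1 of the generating polynomial, each of whose terms contains a
  factor that vanishes there.\<close>

lemma sum_bdf_coeff: "(\<Sum>i=0..k. bdf_coeff k i) = 0"
proof -
  let ?p = "\<Sum>l=1..k. smult (1 / real l) ([:1, -1:] ^ l) :: real poly"
  have "degree ([:1, -1:] ^ l :: real poly) \<le> l" for l
    using degree_power_le[of "[:1, -1:] :: real poly" l] by simp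
  then have "degree ?p \<le> k"
    by (intro degree_sum_le) (auto intro: order_trans)
  then have "(\<Sum>i=0..k. bdf_coeff k i) = poly ?p 1"
    unfolding bdf_coeff_def poly_altdef atMost_atLeast0 power_one mult_1_right
    \<comment> \<open>\<open>poly_altdef\<close> stops at the degree; the coefficients from there up
      to \<open>k\<close> are zero.\<close>
    by (intro sum.mono_neutral_right) (auto simp: coeff_eq_0)
  also have "\<dots> = 0"
    by (auto simp: poly_sum intro!: sum.neutral)
  finally show ?thesis .
qed

lemma bdf_coeff_0_pos:
  assumes "1 \<le> k"
  shows "0 < bdf_coeff k 0"
proof -
  have "bdf_coeff k 0 = (\<Sum>l=1..k. 1 / real l)"
    by (simp add: bdf_coeff_def coeff_sum coeff_0_power)
  also have "\<dots> > 0"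
    using assms by (intro sum_pos) auto
  finally show ?thesis .
qed

lemma bdf_equilibrium:
  assumes "1 \<le> k" and "(\<Sum>i=0..k. bdf_coeff k i * a i) = 0" and "\<And>i. i \<in> {1..k} \<Longrightarrow> a i = c"
  shows "a 0 = c"
proof -
  \<comment> \<open>Subtracting \<open>c\<close> times the zero sum turns the values into deviations
    from \<open>c\<close>, of which only the one at index 0 can survive.\<close>
  have "0 = (\<Sum>i=0..k. bdf_coeff k i * a i) - c * (\<Sum>i=0..k. bdf_coeff k i)"
    using assms(2) by (simp add: sum_bdf_coeff)
  also have "\<dots> = (\<Sum>i=0..k. bdf_coeff k i * (a i - c))"
    by (simp add: sum_distrib_left sum_subtractf algebra_simps)
  also have "\<dots> = bdf_coeff k 0 * (a 0 - c) + (\<Sum>i=1..k. bdf_coeff k i * (a i - c))"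
    by (simp add: sum.atLeast_Suc_atMost)
  also have "(\<Sum>i=1..k. bdf_coeff k i * (a i - c)) = 0"
    using assms(3) by simp
  finally show ?thesis
    using bdf_coeff_0_pos[OF assms(1)] by simp
qed

lemma ap_bdf_system_area:
  assumes "ap_bdf_system N \<rho> k \<tau> P Z \<kappa> \<eta>" and "1 \<le> k" and "\<And>i. i \<in> {1..k} \<Longrightarrow> area (Z i) = c"
  shows "area (Z 0) = c"
  using assms bdf_equilibrium[of k "\<lambda>i. area (Z i)" c] by (simp add: ap_bdf_system_def)

text \<open>The area balance involves the curves of \<open>H\<close> and \<open>Y\<close> but not
  the area of the predicted polygon, so a case distinction on the order replaces an induction
  through the nested predictors.\<close>

lemma ap_bdf_step_area:
  assumes "ap_bdf_step N \<rho> k \<tau> H Y" and "\<And>i. i < k \<Longrightarrow> area (H i) = c"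
  shows "area Y = c"
proof -
  consider "k = 0" | "k = 1" | l where "k = Suc (Suc l)"
    by (metis One_nat_def not0_implies_Suc)
  then show ?thesis
  proof cases
    case (3 l)
    with assms(1) obtain P \<kappa> \<eta> where "ap_bdf_system N \<rho> k \<tau> P (case_nat Y H) \<kappa> \<eta>"
      by auto
    then have "area (case_nat Y H 0) = c"
      \<comment> \<open>For \<open>i\<close> in \<open>{1..k}\<close>, \<open>case_nat Y H i\<close>
        is \<open>H (i - 1)\<close>, and \<open>i - 1 < k\<close>.\<close>
      by (rule ap_bdf_system_area) (use 3 assms(2) in \<open>auto split: nat.split\<close>)
    then show ?thesis by simp
  qed (use assms in \<open>auto simp: ap_euler_step_def\<close>)
qed

text \<open>Rule induction follows the mutual recursion: a run inherits the area of its starting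
  values, and a starting value that of the lower-order run it ends.\<close>

lemma ap_bdf_run_area:
  "ap_bdf_run N \<rho> k \<tau> M X \<Longrightarrow> \<forall>j\<le>M. area (X j) = area (X 0)"
  and starting_value_area:
  "starting_value N \<rho> k \<tau> X0 j Z \<Longrightarrow> area Z = area X0"
proof (induction rule: ap_bdf_run_starting_value.inducts)
  case (run k \<tau> X M)
  have "area (X j) = area (X 0)" if "j \<le> M" for j
    using that
  \<comment> \<open>Strong induction, since a step draws on \<open>k\<close> earlier curves.\<close>
  proof (induction j rule: less_induct)
    case (less j)
    consider "j = 0" | "1 \<le> j" "j \<le> k - 1" | "k - 1 < j"
      by linarith
    then show ?case
    proof cases
      case 2
      with run less.prems show ?thesis by blast
    next
      case 3
      then obtain m where m: "j = m + 1" "k - 1 \<le> m"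
        by (cases j) auto
      with run less.prems have "ap_bdf_step N \<rho> k \<tau> (\<lambda>i. X (m - i)) (X j)"
        by auto
      then show ?thesis
        by (rule ap_bdf_step_area) (use m less.prems in \<open>auto intro!: less.IH\<close>)
    qed simp
  qed
  then show ?case by blast
qed blast

theorem theorem4p2:
  fixes N k :: nat and \<rho> :: "nat \<Rightarrow> real" and \<tau> :: real
    and X Xt :: "nat \<Rightarrow> real \<Rightarrow> real ^ 2"
    and \<kappa> :: "nat \<Rightarrow> real \<Rightarrow> real" and \<eta> :: "nat \<Rightarrow> real"
  assumes "mesh N \<rho>"
    and "2 \<le> k" and "k \<le> 6" and "0 < \<tau>"
    and "\<forall>j\<in>{0..k - 1}. X j \<in> Vh2 N \<rho>"
    and "\<forall>j\<in>{1..k - 1}. starting_value N \<rho> k \<tau> (X 0) j (X j)"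
    and "\<forall>m\<ge>k - 1. Xt (m + 1) \<in> polygons N \<rho> \<and>
           ap_bdf_step N \<rho> (k - 1) \<tau> (\<lambda>i. X (m - i)) (Xt (m + 1))"
    and "\<forall>m\<ge>k - 1. X (m + 1) \<in> Vh2 N \<rho> \<and> \<kappa> (m + 1) \<in> Vh N \<rho> \<and>
           ap_bdf_system N \<rho> k \<tau> (Xt (m + 1)) (\<lambda>i. X (m + 1 - i)) (\<kappa> (m + 1)) (\<eta> (m + 1))"
  shows "\<forall>m. area (X (m + 1)) = area (X m) \<and> area (X m) = area (X 0)"
proof -
  \<comment> \<open>The argument for runs is repeated on the infinite sequence: the systems are
    given with their own \<open>Xt\<close>, \<open>\<kappa>\<close> and \<open>\<eta>\<close>, so
    \<open>ap_bdf_system_area\<close> applies directly.\<close>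
  have *: "area (X j) = area (X 0)" for j
  proof (induction j rule: less_induct)
    case (less j)
    consider "j = 0" | "1 \<le> j" "j \<le> k - 1" | "k - 1 < j"
      by linarith
    then show ?case
    proof cases
      case 2
      with assms(6) show ?thesis by (intro starting_value_area) auto
    next
      case 3
      then obtain m where m: "j = m + 1" "k - 1 \<le> m"
        by (cases j) auto
      with assms(8) have "ap_bdf_system N \<rho> k \<tau> (Xt j) (\<lambda>i. X (j - i)) (\<kappa> j) (\<eta> j)"
        by auto
      \<comment> \<open>Written with \<open>j - 0\<close> to match \<open>Z 0\<close> for the
        backward numbering \<open>X (j - i)\<close>.\<close>
      then have "area (X (j - 0)) = area (X 0)"
        by (rule ap_bdf_system_area) (use m assms(2) in \<open>auto intro!: less.IH\<close>)
      then show ?thesis by simp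
    qed simp
  qed
  show ?thesis
    using * by metis
qed

end
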